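(* Let $x,y_1,\dots,y_n$ be vectors of an inner product space $(H;(\cdot,\cdot))$ over $\mathbb{K}$. If $m>1$ and $\frac1m+\frac1l=1$, then $$\sum_{i=1}^n|(x,y_i)|^2\le n^{\frac1m}\|x\|^2\left(\sum_{i=1}^n\left[\max_{1\le j\le n}|(y_i,y_j)|\right]^l\right)^{\frac1l}.$$
   Context: $(H;(\cdot,\cdot))$ is an inner product space over the real or complex number field $\mathbb{K}$; $\|x\|=(x,x)^{1/2}$; $n\ge 1$ is an integer. *)

theory Defs
  imports "HOL-Analysis.Inner_Product"
begin

class complex_vector = ab_group_add +
  fixes scaleC :: "complex \<Rightarrow> 'a \<Rightarrow> 'a"
  assumes scaleC_add_right: "scaleC a (x + y) = scaleC a x + scaleC a y"
    and scaleC_add_left: "scaleC (a + b) x = scaleC a x + scaleC b x"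
    and scaleC_scaleC: "scaleC a (scaleC b x) = scaleC (a * b) x"
    and scaleC_one: "scaleC 1 x = x"

(* Complex counterpart of the library class real_inner, linear in the first argument.
   cinner_commute makes cinner x x real, so cinner_ge_zero says cinner x x >= 0. *)
class complex_inner = complex_vector +
  fixes cinner :: "'a \<Rightarrow> 'a \<Rightarrow> complex"
  assumes cinner_commute: "cinner x y = cnj (cinner y x)"
    and cinner_add_left: "cinner (x + y) z = cinner x z + cinner y z"
    and cinner_scaleC_left: "cinner (scaleC a x) y = a * cinner x y"
    and cinner_ge_zero: "0 \<le> Re (cinner x x)"
    and cinner_eq_zero_iff: "cinner x x = 0 \<longleftrightarrow> x = 0"

definition cinner_norm :: "'a::complex_inner \<Rightarrow> real"
  where "cinner_norm x = sqrt (Re (cinner x x))"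

instantiation complex :: complex_inner
begin

definition scaleC_complex :: "complex \<Rightarrow> complex \<Rightarrow> complex"
  where "scaleC_complex a x = a * x"

definition cinner_complex :: "complex \<Rightarrow> complex \<Rightarrow> complex"
  where "cinner_complex x y = x * cnj y"

instance
  by standard
    (auto simp: scaleC_complex_def cinner_complex_def algebra_simps)

end

end

theory Submission
  imports Defs "HOL-Analysis.Convex"
begin

text \<open>
  Write \<open>c\<^sub>i\<close> for the inner product of \<open>x\<close> with \<open>y\<^sub>i\<close>, \<open>S\<close> for the sum of the \<open>|c\<^sub>i|\<^sup>2\<close>, and
  \<open>M\<^sub>i\<close> for the largest absolute value in row \<open>i\<close> of the Gram matrix \<open>G\<close> of the \<open>y\<^sub>i\<close>. The vector
  \<open>z = \<Sum>\<^sub>i c\<^sub>i y\<^sub>i\<close> satisfies \<open>(x, z) = S\<close>, and \<open>\<parallel>z\<parallel>\<^sup>2\<close> is at most the sum of all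
  \<open>|c\<^sub>i| |c\<^sub>j| |G\<^sub>i\<^sub>j|\<close>. Since \<open>|c\<^sub>i| |c\<^sub>j| \<le> (|c\<^sub>i|\<^sup>2 + |c\<^sub>j|\<^sup>2) / 2\<close> and \<open>|G\<^sub>i\<^sub>j|\<close> is bounded both by
  \<open>M\<^sub>i\<close> and by \<open>M\<^sub>j\<close>, that double sum is at most \<open>S \<cdot> \<Sum>\<^sub>j M\<^sub>j\<close>. The Cauchy--Schwarz inequality
  \<open>S\<^sup>2 \<le> \<parallel>x\<parallel>\<^sup>2 \<parallel>z\<parallel>\<^sup>2\<close> then gives \<open>S \<le> \<parallel>x\<parallel>\<^sup>2 \<cdot> \<Sum>\<^sub>j M\<^sub>j\<close>, and the power mean inequality turns the
  sum of the \<open>M\<^sub>j\<close> into \<open>n\<^bsup>1/m\<^esup> (\<Sum>\<^sub>j M\<^sub>j\<^sup>l)\<^bsup>1/l\<^esup>\<close>.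

  The real and the complex case share everything after the expansion of \<open>\<parallel>x - t z\<parallel>\<^sup>2\<close>: the
  Cauchy--Schwarz step is phrased as nonnegativity of this quadratic polynomial in a real \<open>t\<close>
  (\<open>sum_squares_le_of_quadratic\<close>), which mentions absolute values only.
\<close>

section \<open>Inequalities between real sums\<close>

text \<open>The power mean inequality, that is Hoelder's inequality against the constant 1: Young's
  inequality applies to each \<open>M\<^sub>i / A\<close> and 1, where \<open>A\<close> is the \<open>l\<close>-th power mean of the \<open>M\<^sub>i\<close>.\<close>

lemma sum_le_card_powr_mult_sum_powr:
  fixes M :: "'i \<Rightarrow> real"
  assumes "finite I" and M: "\<And>i. i \<in> I \<Longrightarrow> 0 \<le> M i"
    and m: "m > 1" and ml: "1 / m + 1 / l = 1"
  shows "(\<Sum>i\<in>I. M i) \<le> real (card I) powr (1 / m) * (\<Sum>i\<in>I. M i powr l) powr (1 / l)"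
proof -
  define N T where "N = real (card I)" and "T = (\<Sum>i\<in>I. M i powr l)"
  have "0 < 1 / m" "1 / m < 1"
    using m by auto
  then have "0 < 1 / l" "1 / l < 1"
    using ml by linarith+
  then have l: "l > 1"
    by (simp add: divide_less_eq_1)
  have T0: "T \<ge> 0"
    by (simp add: T_def sum_nonneg)
  show ?thesis
  proof (cases "T = 0")
    case True
    then have "\<forall>i\<in>I. M i = 0"
      using \<open>finite I\<close> by (simp add: T_def sum_nonneg_eq_0_iff)
    then show ?thesis by simp
  next
    case False
    then have T: "T > 0" using T0 by simp
    then have "I \<noteq> {}" by (auto simp: T_def)
    then have N: "N > 0"
      using \<open>finite I\<close> by (simp add: N_def card_gt_0_iff)
    define A where "A = (T / N) powr (1 / l)"
    have A: "A > 0" "A powr l = T / N"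
      using T N l by (simp_all add: A_def powr_powr)
    have "M i / A \<le> M i powr l / (A powr l) / l + 1 / m" if "i \<in> I" for i
      using Youngs_inequality[of l m "M i / A" 1] l m ml M[OF that] A(1)
      by (simp add: powr_divide add.commute)
    then have "(\<Sum>i\<in>I. M i / A) \<le> (\<Sum>i\<in>I. M i powr l / (A powr l) / l + 1 / m)"
      by (intro sum_mono)
    also have "\<dots> = T / (A powr l) / l + N / m"
      by (simp add: sum.distrib T_def N_def flip: sum_divide_distrib)
    also have "\<dots> = N * (1 / m + 1 / l)"
      using T N unfolding A(2) by (simp add: distrib_left)
    finally have "(\<Sum>i\<in>I. M i) / A \<le> N"
      unfolding ml by (simp flip: sum_divide_distrib)
    then have "(\<Sum>i\<in>I. M i) \<le> N * A"
      using A(1) by (simp add: divide_le_eq)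
    also have "\<dots> = N powr (1 - 1 / l) * T powr (1 / l)"
      using N T by (simp add: A_def powr_divide powr_diff)
    also have "1 - 1 / l = 1 / m"
      using ml by simp
    finally show ?thesis
      by (simp add: N_def T_def)
  qed
qed

lemma quadratic_form_le_sum_bounds:
  fixes a M :: "'i \<Rightarrow> real"
  assumes a: "\<And>i. i \<in> I \<Longrightarrow> 0 \<le> a i"
    and g: "\<And>i j. i \<in> I \<Longrightarrow> j \<in> I \<Longrightarrow> 0 \<le> g i j \<and> g i j \<le> M i \<and> g i j \<le> M j"
  shows "(\<Sum>i\<in>I. \<Sum>j\<in>I. a i * a j * g i j) \<le> (\<Sum>i\<in>I. (a i)\<^sup>2) * (\<Sum>j\<in>I. M j)"
proof -
  have "a i * a j * g i j \<le> ((a i)\<^sup>2 * M j + M i * (a j)\<^sup>2) / 2" if "i \<in> I" "j \<in> I" for i j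
  proof -
    have "2 * (a i * a j) \<le> (a i)\<^sup>2 + (a j)\<^sup>2"
      using sum_squares_bound[of "a i" "a j"] by (simp add: mult.assoc)
    then have "2 * (a i * a j) * g i j \<le> ((a i)\<^sup>2 + (a j)\<^sup>2) * g i j"
      using g[OF that] by (intro mult_right_mono) auto
    also have "\<dots> = (a i)\<^sup>2 * g i j + g i j * (a j)\<^sup>2"
      by (simp add: algebra_simps)
    also have "\<dots> \<le> (a i)\<^sup>2 * M j + M i * (a j)\<^sup>2"
      using g[OF that] by (intro add_mono mult_left_mono mult_right_mono) auto
    finally show ?thesis by simp
  qed
  then have "(\<Sum>i\<in>I. \<Sum>j\<in>I. a i * a j * g i j)
      \<le> (\<Sum>i\<in>I. \<Sum>j\<in>I. ((a i)\<^sup>2 * M j + M i * (a j)\<^sup>2) / 2)"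
    by (intro sum_mono)
  also have "\<dots> = (\<Sum>i\<in>I. (a i)\<^sup>2) * (\<Sum>j\<in>I. M j)"
    unfolding sum_divide_distrib[symmetric] sum.distrib sum_product[symmetric] by simp
  finally show ?thesis .
qed

text \<open>In the applications \<open>X\<close> is \<open>\<parallel>x\<parallel>\<^sup>2\<close> and the quadratic polynomial bounds \<open>\<parallel>x - t z\<parallel>\<^sup>2\<close> from
  above. Unless all \<open>M\<^sub>j\<close> vanish, its nonnegativity at the reciprocal of their sum gives the claim.\<close>

lemma sum_squares_le_of_quadratic:
  fixes a M :: "'i \<Rightarrow> real"
  assumes a: "\<And>i. i \<in> I \<Longrightarrow> 0 \<le> a i"
    and g: "\<And>i j. i \<in> I \<Longrightarrow> j \<in> I \<Longrightarrow> 0 \<le> g i j \<and> g i j \<le> M i \<and> g i j \<le> M j"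
    and quad: "\<And>t. 0 \<le> X - 2 * t * (\<Sum>i\<in>I. (a i)\<^sup>2) + t\<^sup>2 * (\<Sum>i\<in>I. \<Sum>j\<in>I. a i * a j * g i j)"
  shows "(\<Sum>i\<in>I. (a i)\<^sup>2) \<le> X * (\<Sum>j\<in>I. M j)"
proof -
  define S K where "S = (\<Sum>i\<in>I. (a i)\<^sup>2)" and "K = (\<Sum>j\<in>I. M j)"
  have "0 \<le> X - 2 * t * S + t\<^sup>2 * (S * K)" for t
    using quad[of t] mult_left_mono[OF quadratic_form_le_sum_bounds[of I a g M, OF a g], of "t\<^sup>2"]
    by (simp add: S_def K_def)
  note q = this
  have "0 \<le> K"
    unfolding K_def using g by (intro sum_nonneg) (meson order_trans)
  then consider "K = 0" | "K > 0" by linarith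
  then have "S \<le> X * K"
  proof cases
    case 1
    \<comment> \<open>The polynomial is now affine in \<open>t\<close>, so a positive \<open>S\<close> would make it negative for large \<open>t\<close>.\<close>
    then show ?thesis
      using q[of "(X + 1) / (2 * S)"] by (cases "S > 0") auto
  next
    case 2
    then show ?thesis
      using q[of "1 / K"] by (simp add: field_simps power2_eq_square)
  qed
  then show ?thesis by (simp add: S_def K_def)
qed

section \<open>Bombieri-type inequalities\<close>

lemma sum_inner_squares_le:
  fixes x :: "'a::real_inner" and y :: "'i \<Rightarrow> 'a"
  assumes "finite I"
  shows "(\<Sum>i\<in>I. \<bar>inner x (y i)\<bar>\<^sup>2)
    \<le> (norm x)\<^sup>2 * (\<Sum>i\<in>I. MAX j\<in>I. \<bar>inner (y i) (y j)\<bar>)"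
proof (rule sum_squares_le_of_quadratic)
  fix t :: real
  define c where "c i = inner x (y i)" for i
  define z where "z = (\<Sum>i\<in>I. c i *\<^sub>R y i)"
  have xz: "inner x z = (\<Sum>i\<in>I. \<bar>c i\<bar>\<^sup>2)"
    by (simp add: z_def inner_sum_right c_def power2_eq_square)
  have "inner z z = (\<Sum>i\<in>I. \<Sum>j\<in>I. c i * c j * inner (y i) (y j))"
    unfolding z_def inner_sum_left by (simp add: inner_sum_right sum_distrib_left mult_ac)
  also have "\<dots> \<le> (\<Sum>i\<in>I. \<Sum>j\<in>I. \<bar>c i\<bar> * \<bar>c j\<bar> * \<bar>inner (y i) (y j)\<bar>)"
    by (intro sum_mono) (simp flip: abs_mult)
  finally have zz: "inner z z \<le> (\<Sum>i\<in>I. \<Sum>j\<in>I. \<bar>c i\<bar> * \<bar>c j\<bar> * \<bar>inner (y i) (y j)\<bar>)" .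
  have "0 \<le> inner (x - t *\<^sub>R z) (x - t *\<^sub>R z)"
    by simp
  also have "\<dots> = (norm x)\<^sup>2 - 2 * t * inner x z + t\<^sup>2 * inner z z"
    unfolding power2_norm_eq_inner
    by (simp add: inner_diff_left inner_diff_right inner_commute[of z x] power2_eq_square algebra_simps)
  finally show "0 \<le> (norm x)\<^sup>2 - 2 * t * (\<Sum>i\<in>I. \<bar>inner x (y i)\<bar>\<^sup>2)
      + t\<^sup>2 * (\<Sum>i\<in>I. \<Sum>j\<in>I. \<bar>inner x (y i)\<bar> * \<bar>inner x (y j)\<bar> * \<bar>inner (y i) (y j)\<bar>)"
    using mult_left_mono[OF zz, of "t\<^sup>2"] by (simp add: xz c_def)
next
  fix i j assume ij: "i \<in> I" "j \<in> I"
  have "\<bar>inner (y p) (y q)\<bar> \<le> (MAX j\<in>I. \<bar>inner (y p) (y j)\<bar>)" if "q \<in> I" for p q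
    using assms that by (intro Max_ge) auto
  from this[of j i] this[of i j] ij show "0 \<le> \<bar>inner (y i) (y j)\<bar> \<and> \<bar>inner (y i) (y j)\<bar> \<le> (MAX j\<in>I. \<bar>inner (y i) (y j)\<bar>)
      \<and> \<bar>inner (y i) (y j)\<bar> \<le> (MAX i\<in>I. \<bar>inner (y j) (y i)\<bar>)"
    by (metis abs_ge_zero inner_commute)
qed simp

lemma cinner_add_right: "cinner x (y + z) = cinner x y + cinner x z"
  for x :: "'a::complex_inner"
  by (metis cinner_add_left cinner_commute complex_cnj_add)

lemma cinner_scaleC_right: "cinner x (scaleC a y) = cnj a * cinner x y"
  for x :: "'a::complex_inner"
  by (metis cinner_commute cinner_scaleC_left complex_cnj_mult)

lemma cinner_zero_left: "cinner 0 x = 0" for x :: "'a::complex_inner"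
  using cinner_add_left[of 0 0 x] by simp

lemma cinner_sum_left: "cinner (\<Sum>i\<in>I. f i) x = (\<Sum>i\<in>I. cinner (f i) x)"
  for x :: "'a::complex_inner"
  by (induction I rule: infinite_finite_induct) (auto simp: cinner_zero_left cinner_add_left)

lemma cinner_sum_right: "cinner x (\<Sum>i\<in>I. f i) = (\<Sum>i\<in>I. cinner x (f i))"
  for x :: "'a::complex_inner"
  by (subst cinner_commute) (simp add: cinner_sum_left cinner_commute[of x])

lemma cmod_cinner_commute: "cmod (cinner x y) = cmod (cinner y x)"
  for x :: "'a::complex_inner"
  by (metis cinner_commute complex_mod_cnj)

lemma sum_cinner_squares_le:
  fixes u :: "'b::complex_inner" and v :: "'i \<Rightarrow> 'b"
  assumes "finite I"
  shows "(\<Sum>i\<in>I. (cmod (cinner u (v i)))\<^sup>2)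
    \<le> (cinner_norm u)\<^sup>2 * (\<Sum>i\<in>I. MAX j\<in>I. cmod (cinner (v i) (v j)))"
proof (rule sum_squares_le_of_quadratic)
  fix t :: real
  define c where "c i = cinner u (v i)" for i
  define z where "z = (\<Sum>i\<in>I. scaleC (c i) (v i))"
  \<comment> \<open>Conjugate linearity in the second argument makes \<open>c i\<close>, not its conjugate, the right coefficient.\<close>
  have uz: "cinner u z = of_real (\<Sum>i\<in>I. (cmod (c i))\<^sup>2)"
    by (simp add: z_def cinner_sum_right cinner_scaleC_right complex_norm_square mult.commute
        del: of_real_power flip: c_def)
  then have zu: "cinner z u = of_real (\<Sum>i\<in>I. (cmod (c i))\<^sup>2)"
    by (subst cinner_commute) simp
  have "cinner z z = (\<Sum>i\<in>I. \<Sum>j\<in>I. c i * cnj (c j) * cinner (v i) (v j))"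
    unfolding z_def cinner_sum_left
    by (simp add: cinner_sum_right cinner_scaleC_left cinner_scaleC_right sum_distrib_left mult_ac)
  then have "Re (cinner z z) = (\<Sum>i\<in>I. \<Sum>j\<in>I. Re (c i * cnj (c j) * cinner (v i) (v j)))"
    by simp
  also have "\<dots> \<le> (\<Sum>i\<in>I. \<Sum>j\<in>I. cmod (c i * cnj (c j) * cinner (v i) (v j)))"
    by (intro sum_mono complex_Re_le_cmod)
  finally have zz: "Re (cinner z z)
      \<le> (\<Sum>i\<in>I. \<Sum>j\<in>I. cmod (c i) * cmod (c j) * cmod (cinner (v i) (v j)))"
    by (simp add: norm_mult)
  define w where "w = u + scaleC (of_real (- t)) z"
  have "cinner w w = cinner u u - of_real t * (cinner u z + cinner z u)
      + of_real (t\<^sup>2) * cinner z z"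
    by (simp add: w_def cinner_add_left cinner_add_right cinner_scaleC_left cinner_scaleC_right
        power2_eq_square algebra_simps)
  then have "Re (cinner w w)
      = Re (cinner u u) - 2 * t * (\<Sum>i\<in>I. (cmod (c i))\<^sup>2) + t\<^sup>2 * Re (cinner z z)"
    unfolding uz zu by (simp del: of_real_sum of_real_power)
  moreover have "0 \<le> Re (cinner w w)" "(cinner_norm u)\<^sup>2 = Re (cinner u u)"
    by (simp_all add: cinner_ge_zero cinner_norm_def)
  ultimately show "0 \<le> (cinner_norm u)\<^sup>2 - 2 * t * (\<Sum>i\<in>I. (cmod (cinner u (v i)))\<^sup>2)
      + t\<^sup>2 * (\<Sum>i\<in>I. \<Sum>j\<in>I. cmod (cinner u (v i)) * cmod (cinner u (v j))
                 * cmod (cinner (v i) (v j)))"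
    using mult_left_mono[OF zz, of "t\<^sup>2"] by (simp add: c_def)
next
  fix i j assume ij: "i \<in> I" "j \<in> I"
  have "cmod (cinner (v p) (v q)) \<le> (MAX j\<in>I. cmod (cinner (v p) (v j)))" if "q \<in> I" for p q
    using assms that by (intro Max_ge) auto
  from this[of j i] this[of i j] ij show "0 \<le> cmod (cinner (v i) (v j))
      \<and> cmod (cinner (v i) (v j)) \<le> (MAX j\<in>I. cmod (cinner (v i) (v j)))
      \<and> cmod (cinner (v i) (v j)) \<le> (MAX i\<in>I. cmod (cinner (v j) (v i)))"
    by (metis norm_ge_zero cmod_cinner_commute)
qed simp

theorem mainTheorem3:
  fixes n :: nat and m l :: real
    and x :: "'a::real_inner" and y :: "nat \<Rightarrow> 'a"
    and u :: "'b::complex_inner" and v :: "nat \<Rightarrow> 'b"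
  assumes "n \<ge> 1" and "m > 1" and "1 / m + 1 / l = 1"
  shows
    "(\<Sum>i=1..n. \<bar>inner x (y i)\<bar>\<^sup>2)
        \<le> real n powr (1 / m) * (norm x)\<^sup>2 *
          (\<Sum>i=1..n. (MAX j\<in>{1..n}. \<bar>inner (y i) (y j)\<bar>) powr l) powr (1 / l)
     \<and> (\<Sum>i=1..n. (cmod (cinner u (v i)))\<^sup>2)
        \<le> real n powr (1 / m) * (cinner_norm u)\<^sup>2 *
          (\<Sum>i=1..n. (MAX j\<in>{1..n}. cmod (cinner (v i) (v j))) powr l) powr (1 / l)"
proof -
  have combine: "S \<le> real n powr (1 / m) * X\<^sup>2 * (\<Sum>i=1..n. (MAX j\<in>{1..n}. g i j) powr l) powr (1 / l)"
    if S: "S \<le> X\<^sup>2 * (\<Sum>i=1..n. MAX j\<in>{1..n}. g i j)" and g: "\<And>i j. 0 \<le> g i j"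
    for S X :: real and g :: "nat \<Rightarrow> nat \<Rightarrow> real"
  proof -
    have "0 \<le> (MAX j\<in>{1..n}. g i j)" if "i \<in> {1..n}" for i
      using that by (intro order_trans[OF g[of i i]] Max_ge) auto
    then have "(\<Sum>i=1..n. MAX j\<in>{1..n}. g i j)
        \<le> real n powr (1 / m) * (\<Sum>i=1..n. (MAX j\<in>{1..n}. g i j) powr l) powr (1 / l)"
      using sum_le_card_powr_mult_sum_powr[of "{1..n}" "\<lambda>i. MAX j\<in>{1..n}. g i j" m l] assms by simp
    from mult_left_mono[OF this, of "X\<^sup>2"] S show ?thesis
      by (simp add: mult.assoc mult.left_commute)
  qed
  show ?thesis
    by (intro conjI combine sum_inner_squares_le sum_cinner_squares_le) auto
qed

end
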